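(* Let $G$ be a connected graph and let $e$ be an edge of $G$. Then $\frac{{\rm gp}(G)}{2}\le {\rm gp}(G-e)\le 2\,{\rm gp}(G)$. Moreover, both bounds are sharp: there exist graphs $G$ and edges $e$ with ${\rm gp}(G-e)={\rm gp}(G)/2$, and there exist graphs $G$ and edges $e$ with ${\rm gp}(G-e)=2\,{\rm gp}(G)$.
   Context: All graphs are simple. A set $X\subseteq V(G)$ is a general position set of $G$ if for every pair of distinct $u,v\in X$ and every shortest $u,v$-path $P$ in $G$ we have $V(P)\cap X=\{u,v\}$ (vertices in different components impose no condition). ${\rm gp}(G)$ is the maximum cardinality of a general position set of $G$. $G-e$ is the graph obtained from $G$ by deleting the edge $e$. *)

theory Defs
  imports "Graph_Theory.Graph_Theory"
begin

text \<open>
  Finite simple graphs are the symmetric loop-free digraphs of \<^locale>\<open>pair_graph\<close>: an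
  undirected edge between \<open>a\<close> and \<open>b\<close> is the pair of arcs \<open>(a, b)\<close>, \<open>(b, a)\<close>.
\<close>

definition shortest_path :: "'a pair_pre_digraph \<Rightarrow> 'a \<Rightarrow> 'a \<Rightarrow> 'a list \<Rightarrow> bool" where
  "shortest_path G u v p \<longleftrightarrow>
     vpath p (with_proj G) \<and> hd p = u \<and> last p = v \<and>
     (\<forall>q. vpath q (with_proj G) \<and> hd q = u \<and> last q = v \<longrightarrow> vwalk_length p \<le> vwalk_length q)"

definition general_position_set :: "'a pair_pre_digraph \<Rightarrow> 'a set \<Rightarrow> bool" where
  "general_position_set G X \<longleftrightarrow>
     X \<subseteq> pverts G \<and>
     (\<forall>u\<in>X. \<forall>v\<in>X. u \<noteq> v \<longrightarrow> (\<forall>p. shortest_path G u v p \<longrightarrow> set p \<inter> X = {u, v}))"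

definition gp :: "'a pair_pre_digraph \<Rightarrow> nat" where
  "gp G = Max {card X | X. general_position_set G X}"

text \<open>Deleting an undirected edge removes both of its arcs.\<close>

definition delete_edge :: "'a pair_pre_digraph \<Rightarrow> 'a \<times> 'a \<Rightarrow> 'a pair_pre_digraph" where
  "delete_edge G e = G\<lparr>parcs := parcs G - {e, prod.swap e}\<rparr>"

lemma pair_graph_delete_edge:
  assumes "pair_graph G"
  shows "pair_graph (delete_edge G e)"
proof -
  interpret pair_graph G by fact
  have "sym (parcs G - {e, prod.swap e})"
    by (rule symI) (use arcs_symmetric in \<open>cases e; fastforce\<close>)
  then show ?thesis
    by unfold_locales
      (auto simp: delete_edge_def symmetric_def pair_finite_verts pair_finite_arcs
        dest: in_arcsD1 in_arcsD2 no_loops')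
qed

lemma
  assumes "pair_graph G"
  shows gp_attained: "\<exists>X. general_position_set G X \<and> card X = gp G"
    and card_le_gp: "general_position_set G X \<Longrightarrow> card X \<le> gp G"
proof -
  interpret pair_graph G by fact
  have "{card X | X. general_position_set G X} \<subseteq> card ` Pow (pverts G)"
    by (auto simp: general_position_set_def)
  then have fin: "finite {card X | X. general_position_set G X}"
    by (rule finite_subset) (simp add: pair_finite_verts)
  moreover have "general_position_set G {}"
    by (simp add: general_position_set_def)
  ultimately have "gp G \<in> {card X | X. general_position_set G X}"
    unfolding gp_def by (intro Max_in) auto
  then show "\<exists>X. general_position_set G X \<and> card X = gp G" by auto
  show "card X \<le> gp G" if "general_position_set G X"
    unfolding gp_def using fin that by (intro Max_ge) auto
qed

end

theory Submission
  imports Defs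
begin

text \<open>
  Let \<open>e = ab\<close>. A shortest path that traverses \<open>e\<close> from \<open>a\<close> to \<open>b\<close> starts strictly closer to \<open>a\<close>
  and ends strictly closer to \<open>b\<close>. Hence, among the vertices that are at least as close to \<open>a\<close>
  as to \<open>b\<close>, the graphs \<open>G\<close> and \<open>G - e\<close> have the same shortest paths and the same general position
  sets; likewise with \<open>a\<close> and \<open>b\<close> exchanged. These two classes cover all vertices, so one of them
  contains half of any given general position set, which gives both bounds.

  For sharpness, every path has \<open>gp \<le> 2\<close>. Removing the middle edge of a path on four vertices
  leaves two disjoint edges, and adding a chord to a path on seven vertices yields a 5-cycle with
  pendant vertices at two adjacent vertices, which has four pairwise non-adjacent vertices at
  mutual distance at most 3.
\<close>

section \<open>Walks and shortest paths\<close>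

lemma vwalk_arcs_splitE:
  assumes "(a, b) \<in> set (vwalk_arcs p)"
  obtains q r where "p = q @ a # b # r"
proof -
  have "\<exists>q r. p = q @ a # b # r"
    using assms
  proof (induction p rule: vwalk_arcs.induct)
    case (3 x y xs)
    show ?case
    proof (cases "(a, b) = (x, y)")
      case True
      then have "x # y # xs = [] @ a # b # xs" by simp
      then show ?thesis by blast
    next
      case False
      with 3 obtain q r where "y # xs = q @ a # b # r" by auto
      then have "x # y # xs = (x # q) @ a # b # r" by simp
      then show ?thesis by blast
    qed
  qed auto
  then show thesis using that by blast
qed

lemma length_vwalk_to_vpath_le: "length (vwalk_to_vpath p) \<le> length p"
proof (induction p rule: vwalk_to_vpath.induct)
  case (2 x xs)
  then show ?case
    using length_dropWhile_le[of "\<lambda>y. y \<noteq> x" xs] by (auto intro: order_trans)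
qed simp

lemma vwalk_rev:
  assumes "pair_graph G" "vwalk p (with_proj G)"
  shows "vwalk (rev p) (with_proj G)"
proof -
  interpret pair_graph G by fact
  show ?thesis using sym_arcs assms(2) by (rule vwalk_rev_ex)
qed

lemma shortest_path_vwalk:
  assumes "shortest_path G u v p"
  shows "vwalk p (with_proj G)" "p \<noteq> []" "hd p = u" "last p = v"
  using assms by (auto simp: shortest_path_def vpath_def)

text \<open>The definition compares \<open>p\<close> only with paths. Cutting the cycles out of a
  walk leaves a path with the same ends and no more vertices, so \<open>p\<close> is minimal among
  walks too.\<close>

lemma shortest_path_length_le:
  assumes "shortest_path G u v p" "vwalk q (with_proj G)" "hd q = u" "last q = v"
  shows "length p \<le> length q"
proof -
  have "vwalk_length p \<le> vwalk_length (vwalk_to_vpath q)"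
    using assms vwalk_to_vpath_vpath[OF assms(2)]
    unfolding shortest_path_def by (metis vwalk_to_vpath_hd vwalk_to_vpath_last)
  \<comment> \<open>\<open>vwalk_length\<close> counts arcs and is 0 for the empty list as well as
    for a single vertex, so passing to numbers of vertices needs nonempty lists.\<close>
  moreover have "p \<noteq> []" "vwalk_to_vpath q \<noteq> []"
    using assms vwalk_to_vpath_nonempty[of q] by (auto simp: shortest_path_def)
  ultimately have "length p \<le> length (vwalk_to_vpath q)"
    by (cases p; cases "vwalk_to_vpath q") auto
  then show ?thesis using length_vwalk_to_vpath_le order_trans by blast
qed

lemma ex_shortest_path:
  assumes "vwalk q (with_proj G)" "hd q = u" "last q = v"
  shows "\<exists>p. shortest_path G u v p"
proof -
  let ?P = "\<lambda>p. vpath p (with_proj G) \<and> hd p = u \<and> last p = v"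
  from vwalk_imp_ex_vpath[OF assms] obtain p where "?P p" by blast
  then obtain p where "?P p" "\<forall>q. ?P q \<longrightarrow> vwalk_length p \<le> vwalk_length q"
    using ex_has_least_nat[of ?P p vwalk_length] by blast
  then show ?thesis unfolding shortest_path_def by blast
qed

lemma shortest_path_rev:
  assumes "pair_graph G" "shortest_path G u v p"
  shows "shortest_path G v u (rev p)"
  unfolding shortest_path_def
proof (intro conjI allI impI)
  show "vpath (rev p) (with_proj G)" "hd (rev p) = v" "last (rev p) = u"
    using assms vwalk_rev[OF assms(1)]
    by (auto simp: shortest_path_def vpath_def hd_rev last_rev)
next
  fix q assume q: "vpath q (with_proj G) \<and> hd q = v \<and> last q = u"
  have "length p \<le> length (rev q)"
    using assms q by (intro shortest_path_length_le[OF assms(2)] vwalk_rev)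
      (auto simp: hd_rev last_rev)
  then show "vwalk_length (rev p) \<le> vwalk_length q" by simp
qed

text \<open>Distances count the vertices of a shortest walk, so they exceed the usual ones by one;
  only comparisons between them matter. For unreachable pairs the value is meaningless.\<close>

definition vdist :: "'a pair_pre_digraph \<Rightarrow> 'a \<Rightarrow> 'a \<Rightarrow> nat" where
  "vdist G u v = (LEAST n. \<exists>p. vwalk p (with_proj G) \<and> hd p = u \<and> last p = v \<and> length p = n)"

lemma vdist_le:
  assumes "vwalk p (with_proj G)" "hd p = u" "last p = v"
  shows "vdist G u v \<le> length p"
  unfolding vdist_def using assms by (intro Least_le) auto

lemma vdist_attained:
  assumes "vwalk p (with_proj G)" "hd p = u" "last p = v"
  obtains q where "vwalk q (with_proj G)" "hd q = u" "last q = v" "length q = vdist G u v"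
  using LeastI[of "\<lambda>n. \<exists>p. vwalk p (with_proj G) \<and> hd p = u \<and> last p = v \<and> length p = n" "length p"]
    assms that unfolding vdist_def by blast

text \<open>Replacing the part of \<open>p\<close> up to \<open>b\<close> by a shortest walk from
  \<open>u\<close> to \<open>b\<close> cannot shorten \<open>p\<close>. So that part has at most
  \<open>vdist G u b\<close> vertices, and its initial segment ending in \<open>a\<close> has one
  fewer.\<close>

lemma vdist_less_of_arc_on_shortest_path:
  assumes "shortest_path G u v p" "(a, b) \<in> set (vwalk_arcs p)"
  shows "vdist G u a < vdist G u b"
proof -
  from assms(2) obtain q r where p: "p = q @ a # b # r" by (rule vwalk_arcs_splitE)
  note walk = shortest_path_vwalk[OF assms(1)]
  have hd_q: "hd (q @ [a]) = u" "hd (q @ [a, b]) = u"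
    using walk(3) unfolding p by (cases q; simp)+
  have walk_a: "vwalk (q @ [a]) (with_proj G)"
    using walk(1) unfolding p by (auto intro: vwalkI_append_l[of _ "b # r"])
  have walk_b: "vwalk (q @ [a, b]) (with_proj G)"
    using walk(1) unfolding p by (auto intro: vwalkI_append_l[of _ r])
  obtain s where s: "vwalk s (with_proj G)" "hd s = u" "last s = b" "length s = vdist G u b"
    using walk_b hd_q(2) by (rule vdist_attained) auto
  then have "s \<noteq> []" by auto
  \<comment> \<open>Both \<open>s\<close> and \<open>q @ [a, b]\<close> end in \<open>b\<close>, so
    the arc joining \<open>s\<close> to \<open>r\<close> is already an arc of
    \<open>p\<close>.\<close>
  have "vwalk (s @ r) (with_proj G)"
  proof (cases "r = []")
    case False
    with s \<open>s \<noteq> []\<close> walk(1) show ?thesis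
      using set_vwalk_arcs_append2[of "b # r" "q @ [a]"]
      by (auto simp: p vwalk_def vwalk_arcs_append)
  qed (use s in simp)
  moreover have "hd (s @ r) = u" "last (s @ r) = v"
    using s \<open>s \<noteq> []\<close> walk(4) by (auto simp: p split: if_splits)
  ultimately have "length p \<le> length (s @ r)"
    by (rule shortest_path_length_le[OF assms(1)])
  moreover have "vdist G u a \<le> length (q @ [a])"
    using walk_a hd_q by (intro vdist_le) auto
  ultimately show ?thesis using s(4) by (simp add: p)
qed

lemma vdist_less_of_arc_on_shortest_path':
  assumes "pair_graph G" "shortest_path G u v p" "(a, b) \<in> set (vwalk_arcs p)"
  shows "vdist G v b < vdist G v a"
  using assms by (intro vdist_less_of_arc_on_shortest_path[OF shortest_path_rev])
    (force simp: set_vwalk_arcs_rev)+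

section \<open>Deleting an edge\<close>

lemma delete_edge_sel [simp]:
  "pverts (delete_edge G e) = pverts G"
  "parcs (delete_edge G e) = parcs G - {e, prod.swap e}"
  by (simp_all add: delete_edge_def)

lemma delete_edge_commute: "delete_edge G (b, a) = delete_edge G (a, b)"
  by (simp add: delete_edge_def insert_commute)

text \<open>A shortest path of \<open>G\<close> from \<open>u\<close> to \<open>v\<close> cannot
  cross from \<open>b\<close> to \<open>a\<close>, as \<open>u\<close> would be strictly closer to
  \<open>b\<close>, nor from \<open>a\<close> to \<open>b\<close>, as \<open>v\<close> would be. All
  of them survive the deletion, so the distance between \<open>u\<close> and \<open>v\<close> does
  not change.\<close>

lemma shortest_path_delete_edge_iff:
  assumes "pair_graph G" "vdist G u a \<le> vdist G u b" "vdist G v a \<le> vdist G v b"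
  shows "shortest_path (delete_edge G (a, b)) u v p \<longleftrightarrow> shortest_path G u v p"
proof -
  let ?H = "delete_edge G (a, b)"
  have up: "vpath q (with_proj G)" if "vpath q (with_proj ?H)" for q
    using that by (auto simp: vpath_def vwalk_def)
  have down: "vpath q (with_proj ?H)" if "shortest_path G u v q" for q
    using that assms vdist_less_of_arc_on_shortest_path[OF that, of b a]
      vdist_less_of_arc_on_shortest_path'[OF assms(1) that, of a b]
    by (auto simp: shortest_path_def vpath_def vwalk_def)
  show ?thesis
  proof
    assume p: "shortest_path ?H u v p"
    then have pG: "vpath p (with_proj G)" "hd p = u" "last p = v"
      using up by (auto simp: shortest_path_def)
    \<comment> \<open>A shortest path of \<open>G\<close> is also a walk of \<open>?H\<close>, so
      \<open>p\<close> is no longer than it and hence shortest in \<open>G\<close> as well.\<close>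
    obtain q where q: "shortest_path G u v q"
      using ex_shortest_path[OF _ pG(2,3)] pG(1) unfolding vpath_def by metis
    have "vwalk q (with_proj ?H)"
      using down[OF q] unfolding vpath_def by (rule conjunct1)
    then have pq: "length p \<le> length q"
      using shortest_path_length_le[OF p] shortest_path_vwalk[OF q] by simp
    have "vwalk_length p \<le> vwalk_length r"
      if "vpath r (with_proj G)" "hd r = u" "last r = v" for r
    proof -
      have "length q \<le> length r"
        using that by (intro shortest_path_length_le[OF q]) (auto simp: vpath_def)
      with pq show ?thesis by simp
    qed
    with pG show "shortest_path G u v p" by (simp add: shortest_path_def)
  next
    assume p: "shortest_path G u v p"
    have "vwalk_length p \<le> vwalk_length r"
      if "vpath r (with_proj ?H)" "hd r = u" "last r = v" for r
      using p up[OF that(1)] that(2,3) by (simp add: shortest_path_def)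
    with down[OF p] shortest_path_vwalk[OF p] show "shortest_path ?H u v p"
      by (simp add: shortest_path_def)
  qed
qed

lemma general_position_set_subset:
  assumes "general_position_set G X" "Y \<subseteq> X"
  shows "general_position_set G Y"
  unfolding general_position_set_def
proof (intro conjI ballI impI allI)
  show "Y \<subseteq> pverts G" using assms by (auto simp: general_position_set_def)
next
  fix u v p assume uv: "u \<in> Y" "v \<in> Y" "u \<noteq> v" "shortest_path G u v p"
  then have "set p \<inter> X = {u, v}"
    using assms unfolding general_position_set_def by blast
  then show "set p \<inter> Y = {u, v}" using uv assms(2) by blast
qed

lemma general_position_set_delete_edge_iff:
  assumes "pair_graph G" "\<And>x. x \<in> X \<Longrightarrow> vdist G x a \<le> vdist G x b"
  shows "general_position_set (delete_edge G (a, b)) X \<longleftrightarrow> general_position_set G X"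
  using shortest_path_delete_edge_iff[OF assms(1)] assms(2)
  by (simp add: general_position_set_def)

text \<open>\<open>H\<close> will be \<open>G\<close> or the graph without the edge, but the halves
  are always cut by distances in \<open>G\<close>. Ties lie in both halves, which is harmless for an
  upper bound.\<close>

lemma card_le_twice_gp:
  assumes "pair_graph H" "finite X"
    "general_position_set H {x \<in> X. vdist G x a \<le> vdist G x b}"
    "general_position_set H {x \<in> X. vdist G x b \<le> vdist G x a}"
  shows "card X \<le> 2 * gp H"
proof -
  have "X = {x \<in> X. vdist G x a \<le> vdist G x b} \<union> {x \<in> X. vdist G x b \<le> vdist G x a}"
    by auto
  then have "card X \<le> card {x \<in> X. vdist G x a \<le> vdist G x b}
      + card {x \<in> X. vdist G x b \<le> vdist G x a}"
    by (metis card_Un_le)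
  also have "\<dots> \<le> gp H + gp H"
    using assms by (intro add_mono card_le_gp)
  finally show ?thesis by simp
qed

lemma finite_general_position_set:
  assumes "pair_graph G" "general_position_set G X"
  shows "finite X"
proof -
  interpret pair_graph G by fact
  show ?thesis
    using assms(2) pair_finite_verts by (auto simp: general_position_set_def intro: finite_subset)
qed

lemma gp_delete_edge_bounds:
  assumes "pair_graph G"
  shows "gp G \<le> 2 * gp (delete_edge G e)" and "gp (delete_edge G e) \<le> 2 * gp G"
proof -
  obtain a b where e: "e = (a, b)" by (cases e)
  let ?H = "delete_edge G (a, b)"
  have H: "pair_graph ?H" by (rule pair_graph_delete_edge[OF assms])
  have iff_a: "general_position_set ?H {x \<in> X. vdist G x a \<le> vdist G x b} \<longleftrightarrow>
      general_position_set G {x \<in> X. vdist G x a \<le> vdist G x b}" for X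
    by (rule general_position_set_delete_edge_iff[OF assms]) simp
  have iff_b: "general_position_set ?H {x \<in> X. vdist G x b \<le> vdist G x a} \<longleftrightarrow>
      general_position_set G {x \<in> X. vdist G x b \<le> vdist G x a}" for X
    unfolding delete_edge_commute[of G a b]
    by (rule general_position_set_delete_edge_iff[OF assms]) simp
  obtain X where X: "general_position_set G X" "card X = gp G"
    using gp_attained[OF assms] by blast
  have "card X \<le> 2 * gp ?H"
    using X(1) by (intro card_le_twice_gp[OF H, of X G a b] finite_general_position_set[OF assms])
      (auto simp: iff_a iff_b elim: general_position_set_subset)
  with X e show "gp G \<le> 2 * gp (delete_edge G e)" by simp
  \<comment> \<open>For the other bound the halves are still cut by distances in \<open>G\<close>,
    and the same equivalences carry them from \<open>?H\<close> back to \<open>G\<close>.\<close>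
  obtain Y where Y: "general_position_set ?H Y" "card Y = gp ?H"
    using gp_attained[OF H] by blast
  have "card Y \<le> 2 * gp G"
    using Y(1) by (intro card_le_twice_gp[OF assms, of Y G a b] finite_general_position_set[OF H])
      (auto simp flip: iff_a iff_b elim: general_position_set_subset)
  with Y e show "gp (delete_edge G e) \<le> 2 * gp G" by simp
qed

section \<open>Extremal examples\<close>

definition path_graph :: "nat \<Rightarrow> nat pair_pre_digraph" where
  "path_graph n = \<lparr>pverts = {..<n},
     parcs = {(i, j). i < n \<and> j < n \<and> (j = Suc i \<or> i = Suc j)}\<rparr>"

definition path_with_chord :: "nat \<Rightarrow> nat \<Rightarrow> nat \<Rightarrow> nat pair_pre_digraph" where
  "path_with_chord n a b = \<lparr>pverts = {..<n},
     parcs = parcs (path_graph n) \<union> {(a, b), (b, a)}\<rparr>"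

lemma pair_graph_path_graph: "pair_graph (path_graph n)"
proof -
  have "finite {(i, j). i < n \<and> j < n \<and> (j = Suc i \<or> i = Suc j)}"
    by (rule finite_subset[of _ "{..<n} \<times> {..<n}"]) auto
  then show ?thesis
    by unfold_locales (auto simp: path_graph_def symmetric_def sym_def)
qed

lemma pair_graph_path_with_chord:
  assumes "a < n" "b < n" "a \<noteq> b"
  shows "pair_graph (path_with_chord n a b)"
proof -
  interpret P: pair_graph "path_graph n" by (rule pair_graph_path_graph)
  show ?thesis
    using assms P.pair_finite_arcs
    by unfold_locales (auto simp: path_with_chord_def path_graph_def symmetric_def sym_def)
qed

text \<open>The hypotheses keep \<open>(a, b)\<close> apart from the edges of the path, none of
  which the deletion may remove.\<close>

lemma delete_chord:
  assumes "b \<noteq> Suc a" "a \<noteq> Suc b"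
  shows "delete_edge (path_with_chord n a b) (a, b) = path_graph n"
  using assms by (auto simp: delete_edge_def path_with_chord_def path_graph_def)

lemma connected_of_path_graph_subset:
  assumes "pair_graph G" "pverts G = {..<n}" "n > 0" "parcs (path_graph n) \<subseteq> parcs G"
  shows "Digraph_Component.connected (with_proj G)"
proof -
  interpret pair_graph G by fact
  have reach: "0 \<rightarrow>\<^sup>*\<^bsub>with_proj G\<^esub> v" if "v < n" for v
    using that
  proof (induction v)
    case 0
    then show ?case using assms(2) by (intro reachable_refl) simp
  next
    case (Suc v)
    then have "(v, Suc v) \<in> parcs G"
      using assms(4) by (auto simp: path_graph_def)
    with Suc show ?case by (auto intro: reachable_adj_trans)
  qed
  have "u \<rightarrow>\<^sup>*\<^bsub>with_proj G\<^esub> v" if "u < n" "v < n" for u v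
    using reachable_trans[OF symmetric_reachable'[OF reach[OF that(1)]] reach[OF that(2)]] .
  then show ?thesis
    using assms(2,3) by (intro connectedI) (auto simp: reachable_mk_symmetric_eq[OF sym_arcs])
qed

text \<open>A discrete intermediate value argument: each arc changes the vertex number by one, so no
  walk jumps over \<open>j\<close>.\<close>

lemma vwalk_path_graph_intermediate:
  assumes "vwalk p (with_proj (path_graph n))" "hd p \<le> j" "j \<le> last p"
  shows "j \<in> set p"
  using assms
proof (induction p rule: vwalk_induct)
  case (Cons u v es)
  then show ?case by (cases "u = j") (auto simp: path_graph_def)
qed simp

text \<open>A shortest path from the least to the greatest element of \<open>X\<close> passes
  through all of \<open>X\<close>, so \<open>X\<close> has no further elements.\<close>

lemma gp_path_graph_le: "gp (path_graph n) \<le> 2"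
proof -
  let ?G = "path_graph n"
  have G: "pair_graph ?G" by (rule pair_graph_path_graph)
  interpret pair_graph ?G by (rule G)
  obtain X where X: "general_position_set ?G X" "card X = gp ?G"
    using gp_attained[OF G] by blast
  have fin: "finite X" by (rule finite_general_position_set[OF G X(1)])
  show ?thesis
  proof (cases "card X \<le> 1")
    case False
    then have "X \<noteq> {}" by auto
    let ?i = "Min X" and ?k = "Max X"
    have ik: "?i \<in> X" "?k \<in> X" using fin \<open>X \<noteq> {}\<close> by auto
    have "?i \<noteq> ?k"
    proof
      assume "?i = ?k"
      then have "X \<subseteq> {?i}" using fin by (metis Max_ge Min_le antisym singletonI subsetI)
      then have "card X \<le> 1" using card_mono[of "{?i}" X] by simp
      with False show False by simp
    qed
    have verts: "?i \<in> pverts ?G" "?k \<in> pverts ?G"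
      using ik X(1) by (auto simp: general_position_set_def)
    then have "Digraph_Component.connected (with_proj ?G)"
      by (intro connected_of_path_graph_subset[OF G, of n]) (auto simp: path_graph_def)
    then have "?i \<rightarrow>\<^sup>*\<^bsub>with_proj ?G\<^esub> ?k"
      using symmetric_connected_imp_strongly_connected[OF sym_arcs] verts
      by (auto simp: strongly_connected_def)
    then obtain q where q: "vwalk q (with_proj ?G)" "hd q = ?i" "last q = ?k"
      unfolding reachable_vwalk_conv by blast
    obtain p where p: "shortest_path ?G ?i ?k p"
      using ex_shortest_path[OF q] by (rule exE)
    have "X \<subseteq> set p"
      using vwalk_path_graph_intermediate[OF shortest_path_vwalk(1)[OF p]]
        shortest_path_vwalk[OF p] fin by auto
    moreover have "set p \<inter> X = {?i, ?k}"
      using X(1) ik \<open>?i \<noteq> ?k\<close> p unfolding general_position_set_def by blast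
    ultimately have "X = {?i, ?k}" by blast
    then have "card X = card {?i, ?k}" by (rule arg_cong)
    with X(2) show ?thesis using card_insert_le_m1[of 2 "{?k}" ?i] by simp
  qed (use X in simp)
qed

text \<open>An inner vertex of \<open>X\<close> on a path of length at most 3 would be adjacent to one of its ends.\<close>

lemma general_position_set_of_independent_close:
  assumes "X \<subseteq> pverts G"
    and indep: "\<And>u v. u \<in> X \<Longrightarrow> v \<in> X \<Longrightarrow> (u, v) \<notin> parcs G"
    and close: "\<And>u v. u \<in> X \<Longrightarrow> v \<in> X \<Longrightarrow> u \<noteq> v \<Longrightarrow>
      \<exists>q. vwalk q (with_proj G) \<and> hd q = u \<and> last q = v \<and> length q \<le> 4"
  shows "general_position_set G X"
  unfolding general_position_set_def
proof (intro conjI ballI impI allI)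
  fix u v p assume uv: "u \<in> X" "v \<in> X" "u \<noteq> v" and p: "shortest_path G u v p"
  \<comment> \<open>Four vertices correspond to distance 3.\<close>
  have "length p \<le> 4"
    using close[OF uv] shortest_path_length_le[OF p] by fastforce
  note walk = shortest_path_vwalk[OF p]
  have "w = u \<or> w = v" if w: "w \<in> set p" "w \<in> X" for w
  proof (rule ccontr)
    assume neq: "\<not> (w = u \<or> w = v)"
    obtain q r where qr: "p = q @ w # r" using w by (auto simp: in_set_conv_decomp)
    have "q \<noteq> []" "r \<noteq> []" using neq walk qr by auto
    then obtain y q' z r' where q: "q = q' @ [y]" and r: "r = z # r'"
      by (metis neq_Nil_conv rev_exhaust)
    have arcs: "(y, w) \<in> parcs G" "(w, z) \<in> parcs G"
      using walk(1) set_vwalk_arcs_append2[of "y # w # z # r'" q']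
      by (auto simp: qr q r vwalk_def)
    \<comment> \<open>If \<open>q'\<close> were empty, \<open>y\<close> would be \<open>u\<close>, a
      member of \<open>X\<close> adjacent to \<open>w\<close>; likewise for \<open>z\<close> and
      \<open>v\<close>. With both lists nonempty, \<open>p\<close> has at least five
      vertices.\<close>
    have "q' \<noteq> []" using arcs indep uv w walk(3) by (auto simp: qr q r)
    moreover have "r' \<noteq> []" using arcs indep uv w walk(4) by (auto simp: qr q r)
    ultimately show False using \<open>length p \<le> 4\<close> by (cases q'; cases r') (auto simp: qr q r)
  qed
  moreover have "u \<in> set p" "v \<in> set p" using walk by auto
  ultimately show "set p \<inter> X = {u, v}" using uv by blast
qed (fact assms(1))

lemma gp_path_with_chord_ge: "gp (path_with_chord 7 1 5) \<ge> 4"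
proof -
  \<comment> \<open>The cycle is 1, 2, 3, 4, 5. The set consists of the pendant vertices 0 and 6 and
    of 2 and 4, the cycle neighbours of 1 and 5 away from the chord.\<close>
  let ?G = "path_with_chord 7 1 5" and ?X = "{0, 2, 4, 6 :: nat}"
  \<comment> \<open>One walk for each of the six pairs from \<open>?X\<close>; reversal supplies the
    other orientation.\<close>
  let ?W = "{[0, 1, 2], [0, 1, 5, 4], [0, 1, 5, 6], [2, 3, 4], [2, 1, 5, 6], [4, 5, 6 :: nat]}"
  have G: "pair_graph ?G" by (rule pair_graph_path_with_chord) auto
  have walks: "\<forall>q \<in> ?W. vwalk q (with_proj ?G) \<and> length q \<le> 4"
    by (auto simp: vwalk_def path_with_chord_def path_graph_def)
  have close: "\<exists>q. vwalk q (with_proj ?G) \<and> hd q = u \<and> last q = v \<and> length q \<le> 4"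
    if uv: "u \<in> ?X" "v \<in> ?X" "u \<noteq> v" for u v
  proof -
    have "(\<exists>q \<in> ?W. hd q = u \<and> last q = v) \<or> (\<exists>q \<in> ?W. hd q = v \<and> last q = u)"
      using uv by auto
    then consider q where "q \<in> ?W" "hd q = u" "last q = v"
      | q where "q \<in> ?W" "hd q = v" "last q = u"
      by blast
    then show ?thesis
    proof cases
      case 1
      with walks show ?thesis by blast
    next
      case (2 q)
      then have "vwalk q (with_proj ?G)" "length q \<le> 4" using walks by blast+
      with 2 show ?thesis
        using vwalk_rev[OF G, of q] by (intro exI[of _ "rev q"]) (simp add: hd_rev last_rev)
    qed
  qed
  have "general_position_set ?G ?X"
    by (rule general_position_set_of_independent_close[OF _ _ close])
      (auto simp: path_with_chord_def path_graph_def)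
  from card_le_gp[OF G this] show ?thesis by simp
qed

text \<open>The components are single edges, so no path has an inner vertex and the whole vertex set
  is in general position.\<close>

lemma gp_two_disjoint_edges_ge: "gp (delete_edge (path_graph 4) (1, 2)) \<ge> 4"
proof -
  let ?G = "delete_edge (path_graph 4) (1, 2)"
  have G: "pair_graph ?G" by (intro pair_graph_delete_edge pair_graph_path_graph)
  have arcs: "parcs ?G = {(0, 1), (1, 0), (2, 3), (3, 2)}"
    by (auto simp: path_graph_def)
  have ends: "set p = {hd p, last p}" if p: "vpath p (with_proj ?G)" for p
  proof -
    have "p \<noteq> []" using p by (auto simp: vpath_def)
    then consider x where "p = [x]" | x y where "p = [x, y]" | x y z r where "p = x # y # z # r"
      by (metis list.exhaust)
    then show ?thesis
    proof cases
      case (3 x y z r)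
      \<comment> \<open>In a matching, two consecutive arcs return to the start, but a path has
        distinct vertices.\<close>
      then have "(x, y) \<in> parcs ?G" "(y, z) \<in> parcs ?G" "x \<noteq> z"
        using p by (auto simp: vpath_def vwalk_def)
      then have False unfolding arcs by auto
      then show ?thesis ..
    qed auto
  qed
  have "general_position_set ?G {..<4}"
    unfolding general_position_set_def
  proof (intro conjI ballI impI allI)
    show "{..<4} \<subseteq> pverts ?G" by (simp add: path_graph_def)
  next
    fix u v p assume "u \<in> {..<4}" "v \<in> {..<4}" "shortest_path ?G u v p"
    moreover from this(3) have "set p = {u, v}"
      using ends[of p] by (simp add: shortest_path_def)
    ultimately show "set p \<inter> {..<4} = {u, v}" by auto
  qed
  from card_le_gp[OF G this] show ?thesis by simp
qed

theorem theorem6p2: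
  shows "(\<forall>(G :: 'a pair_pre_digraph) e.
            pair_graph G \<and> Digraph_Component.connected (with_proj G) \<and> e \<in> parcs G \<longrightarrow>
              real (gp G) / 2 \<le> real (gp (delete_edge G e)) \<and>
              real (gp (delete_edge G e)) \<le> 2 * real (gp G))
       \<and> (\<exists>(G :: nat pair_pre_digraph) e.
            pair_graph G \<and> Digraph_Component.connected (with_proj G) \<and> e \<in> parcs G \<and>
              real (gp (delete_edge G e)) = real (gp G) / 2)
       \<and> (\<exists>(G :: nat pair_pre_digraph) e.
            pair_graph G \<and> Digraph_Component.connected (with_proj G) \<and> e \<in> parcs G \<and>
              real (gp (delete_edge G e)) = 2 * real (gp G))"
proof (intro conjI allI impI)
  fix G :: "'a pair_pre_digraph" and e
  assume "pair_graph G \<and> Digraph_Component.connected (with_proj G) \<and> e \<in> parcs G"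
  then have "gp G \<le> 2 * gp (delete_edge G e)" "gp (delete_edge G e) \<le> 2 * gp G"
    by (blast intro: gp_delete_edge_bounds)+
  then show "real (gp G) / 2 \<le> real (gp (delete_edge G e))"
    "real (gp (delete_edge G e)) \<le> 2 * real (gp G)"
    by linarith+
next
  let ?G = "path_with_chord 7 1 5"
  have G: "pair_graph ?G" by (rule pair_graph_path_with_chord) auto
  have "Digraph_Component.connected (with_proj ?G)"
    by (rule connected_of_path_graph_subset[OF G, of 7]) (auto simp: path_with_chord_def)
  moreover have "(1, 5) \<in> parcs ?G" by (simp add: path_with_chord_def)
  moreover have "delete_edge ?G (1, 5) = path_graph 7" by (rule delete_chord) auto
  \<comment> \<open>Equality is forced by the chain 4 \<le> \<open>gp ?G\<close> \<le> 2
    \<open>gp (path_graph 7)\<close> \<le> 4.\<close>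
  then have "gp ?G = 2 * gp (delete_edge ?G (1, 5))"
    using gp_delete_edge_bounds(1)[OF G, of "(1, 5)"] gp_path_with_chord_ge gp_path_graph_le[of 7]
    by simp
  ultimately show "\<exists>(G :: nat pair_pre_digraph) e.
      pair_graph G \<and> Digraph_Component.connected (with_proj G) \<and> e \<in> parcs G \<and>
      real (gp (delete_edge G e)) = real (gp G) / 2"
    using G by (intro exI[of _ ?G] exI[of _ "(1, 5)"]) simp
next
  let ?G = "path_graph 4"
  have G: "pair_graph ?G" by (rule pair_graph_path_graph)
  have "Digraph_Component.connected (with_proj ?G)"
    by (rule connected_of_path_graph_subset[OF G, of 4]) (auto simp: path_graph_def)
  moreover have "(1, 2) \<in> parcs ?G" by (simp add: path_graph_def)
  \<comment> \<open>Here 4 \<le> \<open>gp (delete_edge ?G (1, 2))\<close> \<le> 2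
    \<open>gp ?G\<close> \<le> 4.\<close>
  moreover have "gp (delete_edge ?G (1, 2)) = 2 * gp ?G"
    using gp_delete_edge_bounds(2)[OF G, of "(1, 2)"] gp_two_disjoint_edges_ge
      gp_path_graph_le[of 4] by simp
  ultimately show "\<exists>(G :: nat pair_pre_digraph) e.
      pair_graph G \<and> Digraph_Component.connected (with_proj G) \<and> e \<in> parcs G \<and>
      real (gp (delete_edge G e)) = 2 * real (gp G)"
    using G by (intro exI[of _ ?G] exI[of _ "(1, 2)"]) simp
qed

end
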